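(* Let $(X,S)$ be a coherent configuration and let $(S,\dot\nabla,e)$ be its associated dagger Frobenius structure, where $\dot\nabla_{ab}^c=\sqrt{\frac{\|c\|}{\|a\|\|b\|}}\,\nabla_{ab}^c$. Let $\mathbf v\colon I\to S$ be the valency vector, $\mathbf v_*^a=\sqrt{\|a\|}$ for $a\in S$. Then $\mathbf v$ is an eigenvector of the matrix $\dot\nabla\circ\dot\nabla^\dagger\colon S\to S$ with eigenvalue $n=|X|$.
   Context: Matrices have non-negative real entries and are indexed by finite sets: $f\colon X\to Y$ has entries $f_x^y$; composition is $(g\circ f)_a^c=\sum_b f_a^bg_b^c$; $S\otimes S=S\times S$; $I=\{*\}$; $f^\dagger$ is the transpose. Thus $(\dot\nabla\circ\dot\nabla^\dagger)_a^b=\sum_{p,q\in S}\dot\nabla_{pq}^a\dot\nabla_{pq}^b$. A coherent configuration $(X,S)$ is a finite set $X$ with a partition $S$ of $X\times X$ such that: if $p\in S$ contains some $(x,x)$ then $p\subseteq\mathrm{id}_X$; for $a,b,c\in S$ the number $\nabla_{ab}^c$ of $z\in X$ with $(x,z)\in a$, $(z,y)\in b$ is the same for all $(x,y)\in c$; and $c\in S$ implies $c^{-1}=\{(y,x):(x,y)\in c\}\in S$. The valency $\|a\|$ of $a\in S$ is the number of $y\in X$ with $(x,y)\in a$, for any $x$ for which at least one such $y$ exists (independent of $x$). The unit $e\colon I\to S$ has $e_*^a=1$ if $a\subseteq\mathrm{id}_X$ and $0$ otherwise. *)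

theory Defs
  imports Complex_Main "HOL-Library.Disjoint_Sets"
begin

text \<open>A matrix \<open>f : X \<rightarrow> Y\<close> is a function with \<open>f x y\<close> standing for
  the entry $f_x^y$. Only the entries at indices in \<open>X\<close> and \<open>Y\<close> are meaningful, so
  operations that sum over an index set take it as an explicit argument. The one-point set
  \<open>I\<close> is \<open>UNIV :: unit set\<close>.\<close>

type_synonym ('a, 'b) matrix = "'a \<Rightarrow> 'b \<Rightarrow> real"

text \<open>The composite \<open>g \<circ> f\<close> of \<open>f : A \<rightarrow> B\<close> and \<open>g : B \<rightarrow> C\<close>.\<close>

definition matrix_comp :: "'b set \<Rightarrow> ('b, 'c) matrix \<Rightarrow> ('a, 'b) matrix \<Rightarrow> ('a, 'c) matrix" where
  "matrix_comp B g f = (\<lambda>a c. \<Sum>b\<in>B. f a b * g b c)"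

definition dagger :: "('a, 'b) matrix \<Rightarrow> ('b, 'a) matrix" where
  "dagger f = (\<lambda>b a. f a b)"

definition eigen_equation :: "'a set \<Rightarrow> ('a, 'a) matrix \<Rightarrow> (unit, 'a) matrix \<Rightarrow> real \<Rightarrow> bool" where
  "eigen_equation A M v l \<longleftrightarrow> (\<forall>b\<in>A. matrix_comp A M v () b = l * v () b)"

definition is_eigenvector :: "'a set \<Rightarrow> ('a, 'a) matrix \<Rightarrow> (unit, 'a) matrix \<Rightarrow> real \<Rightarrow> bool" where
  "is_eigenvector A M v l \<longleftrightarrow> (\<exists>a\<in>A. v () a \<noteq> 0) \<and> eigen_equation A M v l"

locale coherent_configuration =
  fixes X :: "'a set" and S :: "'a rel set"
  assumes finite_points: "finite X"
    and partition: "partition_on (X \<times> X) S"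
    and diagonal: "\<And>p x. p \<in> S \<Longrightarrow> (x, x) \<in> p \<Longrightarrow> p \<subseteq> Id_on X"
    and regular: "\<And>a b c. a \<in> S \<Longrightarrow> b \<in> S \<Longrightarrow> c \<in> S \<Longrightarrow>
      \<exists>k. \<forall>(x, y)\<in>c. card {z\<in>X. (x, z) \<in> a \<and> (z, y) \<in> b} = k"
    and converse_closed: "\<And>c. c \<in> S \<Longrightarrow> converse c \<in> S"

text \<open>In a coherent configuration the classes are non-empty, so the numbers singled out by
  the description operator in the next two definitions exist and are unique.\<close>

definition intersection_number :: "'a set \<Rightarrow> 'a rel \<Rightarrow> 'a rel \<Rightarrow> 'a rel \<Rightarrow> nat" where
  "intersection_number X a b c =
    (THE k. \<forall>(x, y)\<in>c. card {z\<in>X. (x, z) \<in> a \<and> (z, y) \<in> b} = k)"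

definition valency :: "'a set \<Rightarrow> 'a rel \<Rightarrow> nat" where
  "valency X a =
    (THE k. \<forall>x\<in>X. (\<exists>y\<in>X. (x, y) \<in> a) \<longrightarrow> card {y\<in>X. (x, y) \<in> a} = k)"

definition nabla_dot :: "'a set \<Rightarrow> ('a rel \<times> 'a rel, 'a rel) matrix" where
  "nabla_dot X = (\<lambda>(a, b) c.
    sqrt (real (valency X c) / (real (valency X a) * real (valency X b)))
      * real (intersection_number X a b c))"

definition unit_matrix :: "'a set \<Rightarrow> (unit, 'a rel) matrix" where
  "unit_matrix X = (\<lambda>_ a. if a \<subseteq> Id_on X then 1 else 0)"

definition associated_structure ::
  "'a set \<Rightarrow> 'a rel set \<Rightarrow>
    'a rel set \<times> ('a rel \<times> 'a rel, 'a rel) matrix \<times> (unit, 'a rel) matrix" where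
  "associated_structure X S = (S, nabla_dot X, unit_matrix X)"

definition valency_vector :: "'a set \<Rightarrow> (unit, 'a rel) matrix" where
  "valency_vector X = (\<lambda>_ a. sqrt (real (valency X a)))"

end

theory Submission
  imports Defs
begin

text \<open>Write $N_{pq}^a$ for the intersection numbers. The factors \<open>sqrt \<parallel>a\<parallel>\<close> combine to
  $$\sum_a \mathbf v^a (\dot\nabla\circ\dot\nabla^\dagger)_a^b
    = \mathbf v^b \sum_{p,q} \frac{N_{pq}^b}{\|p\|\,\|q\|} \sum_a \|a\| N_{pq}^a .$$
  If $N_{pq}^b \neq 0$, then fixing a point \<open>x\<close> in the source of \<open>p\<close> and counting the paths
  $x \to z \to y$ with steps in \<open>p\<close> and \<open>q\<close>, by the class of \<open>(x, y)\<close> or by \<open>z\<close>,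
  shows that the inner sum is $\|p\|\,\|q\|$. It remains that $\sum_{p,q} N_{pq}^b = |X|$, since
  for \<open>(x, y)\<close> in \<open>b\<close> each \<open>z\<close> lies on exactly one pair of classes.\<close>

context coherent_configuration
begin

lemma class_subset: "a \<in> S \<Longrightarrow> a \<subseteq> X \<times> X"
  using partition by (auto simp: partition_on_def)

lemma finite_classes: "finite S"
  using finite_elements[OF _ partition] finite_points by blast

lemma class_nonempty:
  assumes "a \<in> S"
  obtains x y where "x \<in> X" "y \<in> X" "(x, y) \<in> a"
proof -
  have "a \<noteq> {}"
    using assms partition by (auto simp: partition_on_def)
  then show ?thesis
    using that class_subset[OF assms] by fast
qed

lemma ex1_class:
  assumes "x \<in> X" "y \<in> X"
  shows "\<exists>!a\<in>S. (x, y) \<in> a"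
  using partition_onD1[OF partition] disjointD[OF partition_onD2[OF partition]] assms by blast

text \<open>The form in which the partition property enters the double counts: sums of indicators
  over all classes collapse to 1.\<close>

lemma sum_class_of_bool:
  assumes "x \<in> X" "y \<in> X"
  shows "(\<Sum>a\<in>S. of_bool ((x, y) \<in> a)) = (1 :: real)"
proof -
  obtain a where a: "a \<in> S" "(x, y) \<in> a" "\<And>b. b \<in> S \<Longrightarrow> (x, y) \<in> b \<longleftrightarrow> b = a"
    using ex1_class[OF assms] by blast
  have "(\<Sum>b\<in>S. of_bool ((x, y) \<in> b)) = (\<Sum>b\<in>S. if b = a then 1 else (0 :: real))"
    by (intro sum.cong) (auto simp: a(3))
  with a(1) show ?thesis
    using finite_classes by simp
qed

lemma card_eq_sum_of_bool: "real (card {z\<in>X. P z}) = (\<Sum>z\<in>X. of_bool (P z))"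
  using finite_points by (simp add: of_bool_def sum.If_cases Int_def)

lemma intersection_number_eq:
  assumes "a \<in> S" "b \<in> S" "c \<in> S" "(x, y) \<in> c"
  shows "intersection_number X a b c = card {z\<in>X. (x, z) \<in> a \<and> (z, y) \<in> b}"
proof -
  obtain k where k: "\<forall>(x, y)\<in>c. card {z\<in>X. (x, z) \<in> a \<and> (z, y) \<in> b} = k"
    using regular[OF assms(1-3)] by blast
  have "intersection_number X a b c = k"
    unfolding intersection_number_def using k assms(4) by (intro the_equality) auto
  then show ?thesis
    using k assms(4) by auto
qed

lemma card_paths_eq:
  assumes "a \<in> S" "b \<in> S" "c \<in> S" "(x, y) \<in> c" "(x', y') \<in> c"
  shows "card {z\<in>X. (x, z) \<in> a \<and> (z, y) \<in> b} = card {z\<in>X. (x', z) \<in> a \<and> (z, y') \<in> b}"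
  using intersection_number_eq[OF assms(1-4)] intersection_number_eq[OF assms(1-3,5)] by simp

text \<open>Since \<open>d\<close> lies in the diagonal, a path with a first step in
  \<open>d\<close> and a second in \<open>p\<close> can only pause at its source. Such a path exists
  from \<open>x\<close> to \<open>y\<close>, and the number of paths is constant on
  \<open>p\<close>, so one exists from \<open>x'\<close> to \<open>y'\<close> as well.\<close>

lemma diagonal_source:
  assumes p: "p \<in> S" "(x, y) \<in> p" "(x', y') \<in> p" and d: "d \<in> S" "(x, x) \<in> d"
  shows "(x', x') \<in> d"
proof -
  have Id: "d \<subseteq> Id_on X"
    using diagonal d by blast
  have "x \<in> X"
    using class_subset p by blast
  then have "x \<in> {z\<in>X. (x, z) \<in> d \<and> (z, y) \<in> p}"
    using p d by simp
  then have "card {z\<in>X. (x, z) \<in> d \<and> (z, y) \<in> p} \<noteq> 0"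
    using finite_points by auto
  then have "card {z\<in>X. (x', z) \<in> d \<and> (z, y') \<in> p} \<noteq> 0"
    using card_paths_eq[OF d(1) p(1) p] by simp
  then obtain z where "(x', z) \<in> d"
    by (auto simp: card_eq_0_iff)
  with Id show ?thesis
    by (auto simp: Id_on_iff)
qed

text \<open>The out-degree of \<open>x\<close> in \<open>a\<close> is the number of closed paths
  that leave \<open>x\<close> along \<open>a\<close> and return along \<open>converse a\<close>. It
  therefore depends only on the class of \<open>(x, x)\<close>, which all sources of
  \<open>p\<close> share. The case \<open>p = a\<close> makes the valency well defined.\<close>

lemma card_out_source:
  assumes p: "p \<in> S" "(x, y) \<in> p" "(x', y') \<in> p" and a: "a \<in> S"
  shows "card {y\<in>X. (x, y) \<in> a} = card {y\<in>X. (x', y) \<in> a}"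
proof -
  have "x \<in> X"
    using class_subset p by blast
  then obtain d where d: "d \<in> S" "(x, x) \<in> d"
    using ex1_class by blast
  have "(x', x') \<in> d"
    by (rule diagonal_source[OF p d])
  from card_paths_eq[OF a converse_closed[OF a] d this] show ?thesis
    by simp
qed

text \<open>Targets of \<open>p\<close> are sources of \<open>converse p\<close>.\<close>

lemma card_out_target:
  assumes "p \<in> S" "(x, y) \<in> p" "(x', y') \<in> p" "a \<in> S"
  shows "card {z\<in>X. (y, z) \<in> a} = card {z\<in>X. (y', z) \<in> a}"
  using assms by (intro card_out_source[of "converse p" y x y' x' a] converse_closed) auto

lemma valency_eq:
  assumes "a \<in> S" "(x, y) \<in> a"
  shows "valency X a = card {y\<in>X. (x, y) \<in> a}"
  unfolding valency_def
proof (rule the_equality)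
  show "\<forall>x'\<in>X. (\<exists>y\<in>X. (x', y) \<in> a) \<longrightarrow>
      card {y\<in>X. (x', y) \<in> a} = card {y\<in>X. (x, y) \<in> a}"
    using card_out_source[OF assms(1) _ assms(2) assms(1)] by blast
qed (use assms class_subset in blast)

lemma valency_pos:
  assumes "a \<in> S"
  shows "valency X a > 0"
proof -
  obtain x y where xy: "x \<in> X" "y \<in> X" "(x, y) \<in> a"
    using class_nonempty[OF assms] .
  then show ?thesis
    using finite_points by (auto simp: valency_eq[OF assms xy(3)] card_gt_0_iff)
qed

lemma intersection_number_neq_0D:
  assumes "a \<in> S" "b \<in> S" "c \<in> S" "intersection_number X a b c \<noteq> 0"
  obtains x y z where "(x, y) \<in> c" "(x, z) \<in> a" "(z, y) \<in> b"
proof -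
  obtain x y where xy: "(x, y) \<in> c"
    using class_nonempty[OF assms(3)] .
  then have "{z\<in>X. (x, z) \<in> a \<and> (z, y) \<in> b} \<noteq> {}"
    using assms(4) intersection_number_eq[OF assms(1-3) xy] by (metis card.empty)
  then show ?thesis
    using that xy by blast
qed

lemma sum_intersection_number:
  assumes "c \<in> S"
  shows "(\<Sum>a\<in>S. \<Sum>b\<in>S. real (intersection_number X a b c)) = real (card X)"
proof -
  obtain x y where xy: "x \<in> X" "y \<in> X" "(x, y) \<in> c"
    using class_nonempty[OF assms] .
  have "(\<Sum>a\<in>S. \<Sum>b\<in>S. real (intersection_number X a b c)) =
      (\<Sum>a\<in>S. \<Sum>b\<in>S. \<Sum>z\<in>X. of_bool ((x, z) \<in> a) * of_bool ((z, y) \<in> b))"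
    by (intro sum.cong refl)
      (simp add: intersection_number_eq[OF _ _ assms xy(3)] card_eq_sum_of_bool of_bool_conj)
  also have "\<dots> = (\<Sum>a\<in>S. \<Sum>z\<in>X. \<Sum>b\<in>S. of_bool ((x, z) \<in> a) * of_bool ((z, y) \<in> b))"
    by (intro sum.cong refl sum.swap)
  also have "\<dots> = (\<Sum>a\<in>S. \<Sum>z\<in>X. of_bool ((x, z) \<in> a))"
    using xy by (intro sum.cong refl) (simp add: sum_class_of_bool flip: sum_distrib_left)
  also have "\<dots> = (\<Sum>z\<in>X. \<Sum>a\<in>S. of_bool ((x, z) \<in> a))"
    by (rule sum.swap)
  also have "\<dots> = real (card X)"
    using xy by (simp add: sum_class_of_bool)
  finally show ?thesis .
qed

text \<open>The common point \<open>z\<close> makes \<open>p\<close> and \<open>q\<close>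
  composable. Otherwise every intersection number on the left would be 0, while the right side is
  positive.\<close>

lemma sum_valency_intersection_number:
  assumes p: "p \<in> S" "(x, z) \<in> p" and q: "q \<in> S" "(z, y) \<in> q"
  shows "(\<Sum>a\<in>S. real (valency X a) * real (intersection_number X p q a)) =
    real (valency X p) * real (valency X q)"
proof -
  have x: "x \<in> X"
    using class_subset p by blast
  have out: "real (valency X a) * real (intersection_number X p q a) =
      (\<Sum>w\<in>X. of_bool ((x, w) \<in> a) * real (card {u\<in>X. (x, u) \<in> p \<and> (u, w) \<in> q}))"
    if a: "a \<in> S" for a
  proof (cases "\<exists>w. (x, w) \<in> a")
    case True
    then obtain w where "(x, w) \<in> a" ..
    then have "real (valency X a) = (\<Sum>w\<in>X. of_bool ((x, w) \<in> a))"
      using valency_eq[OF a] by (simp only: card_eq_sum_of_bool)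
    then show ?thesis
      using intersection_number_eq[OF p(1) q(1) a]
      by (auto simp: sum_distrib_right intro!: sum.cong)
  next
    \<comment> \<open>The right side vanishes because \<open>x\<close> has no successor in
      \<open>a\<close>. A nonzero intersection number would give a source \<open>x'\<close> of both
      \<open>a\<close> and \<open>p\<close>; then \<open>x\<close>, being a source of
      \<open>p\<close> too, would have the same positive out-degree in \<open>a\<close> as
      \<open>x'\<close>.\<close>
    case False
    have "intersection_number X p q a = 0"
    proof (rule ccontr)
      assume "intersection_number X p q a \<noteq> 0"
      then obtain x' y' z' where *: "(x', y') \<in> a" "(x', z') \<in> p"
        using intersection_number_neq_0D[OF p(1) q(1) a] by metis
      have "card {w\<in>X. (x, w) \<in> a} = valency X a"
        using card_out_source[OF p(1,2) *(2) a] valency_eq[OF a *(1)] by simp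
      with False valency_pos[OF a] show False
        by simp
    qed
    with False show ?thesis
      by simp
  qed
  have "(\<Sum>a\<in>S. real (valency X a) * real (intersection_number X p q a)) =
      (\<Sum>a\<in>S. \<Sum>w\<in>X. of_bool ((x, w) \<in> a) * real (card {u\<in>X. (x, u) \<in> p \<and> (u, w) \<in> q}))"
    using out by simp
  also have "\<dots> =
      (\<Sum>w\<in>X. \<Sum>a\<in>S. of_bool ((x, w) \<in> a) * real (card {u\<in>X. (x, u) \<in> p \<and> (u, w) \<in> q}))"
    by (rule sum.swap)
  also have "\<dots> = (\<Sum>w\<in>X. real (card {u\<in>X. (x, u) \<in> p \<and> (u, w) \<in> q}))"
    using x by (intro sum.cong refl) (simp add: sum_class_of_bool flip: sum_distrib_right)
  also have "\<dots> = (\<Sum>w\<in>X. \<Sum>u\<in>X. of_bool ((x, u) \<in> p) * of_bool ((u, w) \<in> q))"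
    by (simp add: card_eq_sum_of_bool of_bool_conj)
  \<comment> \<open>From here the paths are counted by their midpoint \<open>u\<close> instead of
    their endpoint \<open>w\<close>.\<close>
  also have "\<dots> = (\<Sum>u\<in>X. \<Sum>w\<in>X. of_bool ((x, u) \<in> p) * of_bool ((u, w) \<in> q))"
    by (rule sum.swap)
  also have "\<dots> = (\<Sum>u\<in>X. of_bool ((x, u) \<in> p) * real (card {w\<in>X. (u, w) \<in> q}))"
    by (simp add: card_eq_sum_of_bool sum_distrib_left)
  also have "\<dots> = (\<Sum>u\<in>X. of_bool ((x, u) \<in> p) * real (valency X q))"
  proof (intro sum.cong refl)
    fix u
    \<comment> \<open>Both \<open>u\<close> and \<open>z\<close> are targets of \<open>p\<close>,
      and \<open>z\<close> is a source of \<open>q\<close>.\<close>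
    have "card {w\<in>X. (u, w) \<in> q} = valency X q" if "(x, u) \<in> p"
      using card_out_target[OF p(1) that p(2) q(1)] valency_eq[OF q] by simp
    then show "of_bool ((x, u) \<in> p) * real (card {w\<in>X. (u, w) \<in> q}) =
        of_bool ((x, u) \<in> p) * real (valency X q)"
      by simp
  qed
  also have "\<dots> = real (valency X p) * real (valency X q)"
    by (simp add: valency_eq[OF p] card_eq_sum_of_bool sum_distrib_right)
  finally show ?thesis .
qed

lemma eigen_equation_valency_vector:
  "eigen_equation S (matrix_comp (S \<times> S) (nabla_dot X) (dagger (nabla_dot X)))
    (valency_vector X) (real (card X))"
  unfolding eigen_equation_def
proof
  fix b assume b: "b \<in> S"
  let ?v = "\<lambda>a. real (valency X a)" and ?N = "\<lambda>p q a. real (intersection_number X p q a)"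
  have entry: "sqrt (?v a) * (nabla_dot X (p, q) a * nabla_dot X (p, q) b) =
      sqrt (?v b) * (?N p q b / (?v p * ?v q)) * (?v a * ?N p q a)" for p q a
  proof -
    \<comment> \<open>Equal roots stay as unevaluated pairs, so that both sides agree up to
      rearranging factors; the pairs are squared away afterwards.\<close>
    have "sqrt (?v a) * (nabla_dot X (p, q) a * nabla_dot X (p, q) b) =
        sqrt (?v b) * (?N p q b / ((sqrt (?v p) * sqrt (?v p)) * (sqrt (?v q) * sqrt (?v q)))) *
          ((sqrt (?v a) * sqrt (?v a)) * ?N p q a)"
      by (simp only: nabla_dot_def prod.case real_sqrt_divide real_sqrt_mult
          times_divide_eq_left times_divide_eq_right divide_divide_eq_left mult_ac)
    then show ?thesis
      by simp
  qed
  have inner: "?N p q b / (?v p * ?v q) * (\<Sum>a\<in>S. ?v a * ?N p q a) = ?N p q b"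
    if pq: "p \<in> S" "q \<in> S" for p q
  \<comment> \<open>If the number is 0, both sides vanish whatever the sum is. Otherwise it supplies
    the composable pair that the double count requires, and the positive valencies cancel.\<close>
  proof (cases "intersection_number X p q b = 0")
    case False
    then obtain x y z where "(x, z) \<in> p" "(z, y) \<in> q"
      using intersection_number_neq_0D[OF pq b] by metis
    then show ?thesis
      using sum_valency_intersection_number pq valency_pos[OF pq(1)] valency_pos[OF pq(2)] by simp
  qed simp
  have "matrix_comp S (matrix_comp (S \<times> S) (nabla_dot X) (dagger (nabla_dot X)))
      (valency_vector X) () b =
      (\<Sum>a\<in>S. \<Sum>(p, q)\<in>S \<times> S. sqrt (?v a) * (nabla_dot X (p, q) a * nabla_dot X (p, q) b))"
    by (simp add: matrix_comp_def dagger_def valency_vector_def sum_distrib_left case_prod_unfold)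
  also have "\<dots> = (\<Sum>(p, q)\<in>S \<times> S. \<Sum>a\<in>S.
      sqrt (?v b) * (?N p q b / (?v p * ?v q)) * (?v a * ?N p q a))"
    by (subst sum.swap) (simp add: entry case_prod_unfold)
  also have "\<dots> = (\<Sum>(p, q)\<in>S \<times> S. sqrt (?v b) * ?N p q b)"
    by (intro sum.cong refl)
      (clarsimp simp only: mem_Sigma_iff mult.assoc inner simp flip: sum_distrib_left)
  also have "\<dots> = sqrt (?v b) * (\<Sum>p\<in>S. \<Sum>q\<in>S. ?N p q b)"
    by (simp add: sum_distrib_left sum.cartesian_product case_prod_unfold)
  also have "\<dots> = real (card X) * valency_vector X () b"
    using sum_intersection_number[OF b] by (simp add: valency_vector_def)
  finally show "matrix_comp S (matrix_comp (S \<times> S) (nabla_dot X) (dagger (nabla_dot X)))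
      (valency_vector X) () b = real (card X) * valency_vector X () b" .
qed

end

theorem lemma8p1:
  fixes X :: "'a set" and S :: "'a rel set"
    and nabla :: "('a rel \<times> 'a rel, 'a rel) matrix" and e :: "(unit, 'a rel) matrix"
  assumes "coherent_configuration X S"
    and "(S, nabla, e) = associated_structure X S"
  shows "eigen_equation S (matrix_comp (S \<times> S) nabla (dagger nabla)) (valency_vector X) (real (card X))
    \<and> (X \<noteq> {} \<longrightarrow>
      is_eigenvector S (matrix_comp (S \<times> S) nabla (dagger nabla)) (valency_vector X) (real (card X)))"
proof -
  interpret coherent_configuration X S
    by (rule assms(1))
  have nabla: "nabla = nabla_dot X"
    using assms(2) by (simp add: associated_structure_def)
  \<comment> \<open>A point yields a class, and classes have positive valency. For empty
    \<open>X\<close> there are no classes, so no entry could be nonzero.\<close>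
  have "\<exists>a\<in>S. valency_vector X () a \<noteq> 0" if "X \<noteq> {}"
  proof -
    from that obtain a where a: "a \<in> S"
      using ex1_class by blast
    then show ?thesis
      using valency_pos[OF a] by (auto simp: valency_vector_def)
  qed
  with eigen_equation_valency_vector show ?thesis
    by (simp add: nabla is_eigenvector_def)
qed

end
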